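(* There exists a constant $c_{\rm H}>0$, independent of $K$, such that the following holds. Let $f:\mathbb{R}^d\to\mathbb{R}\cup\{+\infty\}$ be proper, closed, convex and $L$-Lipschitz smooth ($L>0$), with nonempty solution set, $f_*=\min f$, let $\mathbf{x}_*$ be a minimizer and $\|\mathbf{x}_0-\mathbf{x}_*\|\le R$. Let $K\ge1$ and let $\mathbf{x}_0,\dots,\mathbf{x}_K$ be generated by iFGM (see context; in particular $A_k=\alpha_k^2$) with inexact gradients $\tilde\nabla f(\mathbf{x}_k)=\nabla f(\mathbf{x}_k)+\mathbf{e}_k$, $\|\mathbf{e}_k\|^2\le b_k^2$, $b_k\ge0$, $k=0,\dots,K-1$. Then $$f(\mathbf{x}_K)-f_*-\frac{1}{2L}\|\nabla f(\mathbf{x}_K)\|^2\le\frac{4LR^2}{A_K}+\frac{2c_{\rm H}}{L}\sum_{i=0}^{K-1}\alpha_{i+1}b_i^2.$$ In particular, if $b_i\equiv b$, then $$f(\mathbf{x}_K)-f_*-\frac{1}{2L}\|\nabla f(\mathbf{x}_K)\|^2\le \mathcal{O}\left(\frac{LR^2}{K^2}+\frac{K^2b^2}{L}\right),$$ i.e. the left-hand side is at most $C\left(\frac{LR^2}{K^2}+\frac{K^2b^2}{L}\right)$ for a constant $C$ independent of $K$, $L$, $R$ and $b$.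
   Context: iFGM is the Inexact Generalized Fast Gradient Method with all parameters $\lambda_k=1$: $\mathbf{z}_0=\mathbf{x}_0\in\mathbb{R}^d$, $A_0=\alpha_0=1$, and for $k=0,\dots,K-1$: $$\mathbf{y}_{k+1}=\mathbf{x}_k-\tfrac1L\tilde\nabla f(\mathbf{x}_k),\qquad \mathbf{z}_{k+1}=\mathbf{z}_k-\tfrac1L\alpha_k\tilde\nabla f(\mathbf{x}_k),$$ $$\alpha_{k+1}=\frac{1+\sqrt{4A_k+1}}{2},\qquad A_{k+1}=A_k+\alpha_{k+1},\qquad \mathbf{x}_{k+1}=\Big(1-\frac{\alpha_{k+1}}{A_{k+1}}\Big)\mathbf{y}_{k+1}+\frac{\alpha_{k+1}}{A_{k+1}}\mathbf{z}_{k+1}.$$ These recursions give $A_k=\alpha_k^2$. "$L$-Lipschitz smooth" means differentiable with $L$-Lipschitz gradient; $\|\cdot\|$ is the Euclidean norm. *)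

theory Defs
  imports Complex_Main "HOL-Library.Extended_Real" "Jordan_Normal_Form.Matrix"
begin

text \<open>
  The space \<open>\<real>\<^sup>d\<close> is \<open>carrier_vec d\<close>, so that the dimension is an
  ordinary natural number and constants can be chosen before it.  Vectors of this type carry no
  norm or topology of their own; the analytic notions below are therefore spelled out with
  the Euclidean norm.
\<close>

definition enorm :: "real vec \<Rightarrow> real" where
  "enorm v = sqrt (v \<bullet> v)"

definition proper_fun :: "nat \<Rightarrow> (real vec \<Rightarrow> ereal) \<Rightarrow> bool" where
  "proper_fun d f \<longleftrightarrow>
     (\<forall>u\<in>carrier_vec d. f u \<noteq> - \<infinity>) \<and> (\<exists>u\<in>carrier_vec d. f u \<noteq> \<infinity>)"

text \<open>Closedness is (sequential) closedness of the epigraph in \<open>\<real>\<^sup>d \<times> \<real>\<close>.\<close>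

definition closed_fun :: "nat \<Rightarrow> (real vec \<Rightarrow> ereal) \<Rightarrow> bool" where
  "closed_fun d f \<longleftrightarrow>
     (\<forall>U t u s. (\<forall>n::nat. U n \<in> carrier_vec d \<and> f (U n) \<le> ereal (t n)) \<and> u \<in> carrier_vec d \<and>
        (\<lambda>n. enorm (U n - u)) \<longlonglongrightarrow> 0 \<and> t \<longlonglongrightarrow> s \<longrightarrow> f u \<le> ereal s)"

text \<open>The weights are taken strictly between 0 and 1, so no convention for \<open>0 * \<infinity>\<close> is involved.\<close>

definition convex_fun :: "nat \<Rightarrow> (real vec \<Rightarrow> ereal) \<Rightarrow> bool" where
  "convex_fun d f \<longleftrightarrow>
     (\<forall>u\<in>carrier_vec d. \<forall>v\<in>carrier_vec d. \<forall>t::real. 0 < t \<and> t < 1 \<longrightarrow>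
        f ((1 - t) \<cdot>\<^sub>v u + t \<cdot>\<^sub>v v) \<le> ereal (1 - t) * f u + ereal t * f v)"

definition has_gradient :: "nat \<Rightarrow> (real vec \<Rightarrow> real) \<Rightarrow> real vec \<Rightarrow> real vec \<Rightarrow> bool" where
  "has_gradient d F u g \<longleftrightarrow> g \<in> carrier_vec d \<and>
     (\<forall>\<epsilon>>0. \<exists>\<delta>>0. \<forall>v\<in>carrier_vec d. enorm (v - u) < \<delta> \<longrightarrow>
        \<bar>F v - F u - g \<bullet> (v - u)\<bar> \<le> \<epsilon> * enorm (v - u))"

definition gradient :: "nat \<Rightarrow> (real vec \<Rightarrow> ereal) \<Rightarrow> real vec \<Rightarrow> real vec" where
  "gradient d f u = (THE g. has_gradient d (\<lambda>v. real_of_ereal (f v)) u g)"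

text \<open>
  Differentiability is required on all of \<open>\<real>\<^sup>d\<close>; in particular a smooth function is
  finite everywhere.
\<close>

definition lipschitz_smooth :: "nat \<Rightarrow> real \<Rightarrow> (real vec \<Rightarrow> ereal) \<Rightarrow> bool" where
  "lipschitz_smooth d L f \<longleftrightarrow>
     (\<forall>u\<in>carrier_vec d. \<bar>f u\<bar> \<noteq> \<infinity> \<and>
        (\<exists>g. has_gradient d (\<lambda>v. real_of_ereal (f v)) u g)) \<and>
     (\<forall>u\<in>carrier_vec d. \<forall>v\<in>carrier_vec d.
        enorm (gradient d f u - gradient d f v) \<le> L * enorm (u - v))"

definition minimizer :: "nat \<Rightarrow> (real vec \<Rightarrow> ereal) \<Rightarrow> real vec \<Rightarrow> bool" where
  "minimizer d f u \<longleftrightarrow> u \<in> carrier_vec d \<and> (\<forall>v\<in>carrier_vec d. f u \<le> f v)"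

definition min_value :: "nat \<Rightarrow> (real vec \<Rightarrow> ereal) \<Rightarrow> ereal" where
  "min_value d f = (INF u\<in>carrier_vec d. f u)"

definition next_alpha :: "real \<Rightarrow> real" where
  "next_alpha a = (1 + sqrt (4 * a + 1)) / 2"

primrec ifgm_A :: "nat \<Rightarrow> real" where
  "ifgm_A 0 = 1"
| "ifgm_A (Suc k) = ifgm_A k + next_alpha (ifgm_A k)"

primrec ifgm_alpha :: "nat \<Rightarrow> real" where
  "ifgm_alpha 0 = 1"
| "ifgm_alpha (Suc k) = next_alpha (ifgm_A k)"

lemma ifgm_A_Suc: "ifgm_A (Suc k) = ifgm_A k + ifgm_alpha (Suc k)"
  by simp

lemma ifgm_A_pos: "0 < ifgm_A k"
proof (induction k)
  case (Suc k)
  moreover have "0 < next_alpha (ifgm_A k)"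
    using Suc by (simp add: next_alpha_def add_pos_nonneg)
  ultimately show ?case by simp
qed simp

lemma ifgm_A_eq_alpha_squared: "ifgm_A k = (ifgm_alpha k)\<^sup>2"
proof (cases k)
  case (Suc j)
  have "(sqrt (4 * ifgm_A j + 1))\<^sup>2 = 4 * ifgm_A j + 1"
    using ifgm_A_pos[of j] by simp
  then show ?thesis
    using Suc by (simp add: next_alpha_def power2_eq_square field_simps)
qed simp

text \<open>\<open>G k\<close> is the inexact gradient used at \<open>x k\<close>.\<close>

definition iFGM ::
    "real \<Rightarrow> nat \<Rightarrow> (nat \<Rightarrow> real vec) \<Rightarrow> (nat \<Rightarrow> real vec) \<Rightarrow> (nat \<Rightarrow> real vec) \<Rightarrow> (nat \<Rightarrow> real vec) \<Rightarrow> bool"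
  where
  "iFGM L K G x y z \<longleftrightarrow>
     z 0 = x 0 \<and>
     (\<forall>k<K.
        y (Suc k) = x k - (1 / L) \<cdot>\<^sub>v G k \<and>
        z (Suc k) = z k - (1 / L * ifgm_alpha k) \<cdot>\<^sub>v G k \<and>
        x (Suc k) = (1 - ifgm_alpha (Suc k) / ifgm_A (Suc k)) \<cdot>\<^sub>v y (Suc k)
                    + (ifgm_alpha (Suc k) / ifgm_A (Suc k)) \<cdot>\<^sub>v z (Suc k))"

end

theory Submission
  imports Defs
begin

text \<open>
  Let \<open>D\<^sub>k = A\<^sub>k (f(x\<^sub>k) - f\<^sub>* - |\<nabla>f(x\<^sub>k)|\<^sup>2 / (2L))\<close>.  For exact gradients, cocoercivity applied
  to the pairs \<open>(x\<^sub>k, x\<^bsub>k-1\<^esub>)\<close> and \<open>(x\<^sub>k, x\<^sub>*)\<close> shows that \<open>D\<^sub>k + L/2 |z\<^bsub>k+1\<^esub> - x\<^sub>*|\<^sup>2\<close> does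
  not increase.  An error \<open>e\<^sub>k\<close> adds terms in \<open>\<langle>\<nabla>f(x\<^sub>k), e\<^sub>k\<rangle>\<close> and \<open>\<langle>\<nabla>f(x\<^bsub>k+1\<^esub>), e\<^sub>k\<rangle>\<close>, which the
  spare \<open>- A\<^sub>k / (2L) |\<nabla>f(x\<^sub>k)|\<^sup>2\<close> absorbs at the cost of \<open>O(A\<^sub>k b\<^sub>k\<^sup>2 / L)\<close>, and the term
  \<open>\<alpha>\<^sub>k \<langle>e\<^sub>k, z\<^sub>k - x\<^sub>*\<rangle>\<close>.  With \<open>U = max |z\<^sub>k - x\<^sub>*|\<close> the latter is at most
  \<open>\<alpha>\<^sub>k (L U\<^sup>2 / (4 A\<^sub>K) + A\<^sub>K b\<^sub>k\<^sup>2 / L)\<close>; since \<open>\<Sum>\<^bsub>k<K\<^esub> \<alpha>\<^sub>k \<le> A\<^sub>K\<close>, the sum of the first parts is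
  at most \<open>L U\<^sup>2 / 4\<close>, half of what the energy gives back at the index where the maximum is
  attained.
\<close>

section \<open>The Euclidean inner product on vectors\<close>

lemma scalar_prod_self_nonneg: "0 \<le> (v :: real vec) \<bullet> v"
  by (simp add: scalar_prod_def sum_nonneg)

lemma enorm_nonneg: "0 \<le> enorm v"
  by (simp add: enorm_def scalar_prod_self_nonneg)

lemma enorm_sq: "(enorm v)\<^sup>2 = v \<bullet> v"
  by (simp add: enorm_def scalar_prod_self_nonneg)

text \<open>A vanishing sum of squares has only zero coordinates. This covers the degenerate cases
  of Cauchy-Schwarz and removes products with the gradient at a minimizer.\<close>

lemma scalar_prod_self_eq_0:
  fixes v w :: "real vec"
  assumes "v \<in> carrier_vec d" "w \<in> carrier_vec d" "w \<bullet> w = 0"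
  shows "v \<bullet> w = 0"
proof -
  have "\<forall>i\<in>{0..<dim_vec w}. w $ i * w $ i = 0"
    using assms(3) unfolding scalar_prod_def
    by (subst (asm) sum_nonneg_eq_0_iff) auto
  then show ?thesis unfolding scalar_prod_def by (intro sum.neutral) auto
qed

lemma enorm_smult: "enorm (c \<cdot>\<^sub>v v) = \<bar>c\<bar> * enorm v"
proof -
  have "(c \<cdot>\<^sub>v v) \<bullet> (c \<cdot>\<^sub>v v) = c\<^sup>2 * (v \<bullet> v)"
    by (simp add: power2_eq_square)
  then show ?thesis by (simp add: enorm_def real_sqrt_mult)
qed

locale vec_dim = fixes d :: nat
begin

lemmas bilinear =
  add_scalar_prod_distrib[where n = d] scalar_prod_add_distrib[where n = d]
  minus_scalar_prod_distrib[where n = d] scalar_prod_minus_distrib[where n = d]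
  smult_scalar_prod_distrib[where n = d] scalar_prod_smult_distrib[where n = d]

lemmas comm = comm_scalar_prod[where n = d]

lemma minus_smult_sq:
  fixes v w :: "real vec"
  assumes "v \<in> carrier_vec d" "w \<in> carrier_vec d"
  shows "(v - c \<cdot>\<^sub>v w) \<bullet> (v - c \<cdot>\<^sub>v w) = v \<bullet> v - 2 * c * (v \<bullet> w) + c\<^sup>2 * (w \<bullet> w)"
  using assms by (simp add: bilinear comm[of w v] algebra_simps power2_eq_square)

lemma minus_smult_shift:
  fixes u v w :: "real vec"
  assumes "v \<in> carrier_vec d" "w \<in> carrier_vec d" "u \<in> carrier_vec d"
  shows "v + c \<cdot>\<^sub>v w - u = (v - u) + c \<cdot>\<^sub>v w"
    and "v - c \<cdot>\<^sub>v w - u = (v - u) - c \<cdot>\<^sub>v w"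
  using assms by (auto intro!: eq_vecI)

text \<open>Expand the nonnegative square of \<open>v - c \<cdot>\<^sub>v w\<close>. The free weight
  \<open>c\<close> decides how a cross term is split between the two squares.\<close>

lemma young:
  fixes v w :: "real vec"
  assumes "v \<in> carrier_vec d" "w \<in> carrier_vec d"
  shows "2 * c * (v \<bullet> w) \<le> v \<bullet> v + c\<^sup>2 * (w \<bullet> w)"
  using scalar_prod_self_nonneg[of "v - c \<cdot>\<^sub>v w"] minus_smult_sq[OF assms, of c] by simp

lemma cauchy_schwarz:
  fixes v w :: "real vec"
  assumes "v \<in> carrier_vec d" "w \<in> carrier_vec d"
  shows "v \<bullet> w \<le> enorm v * enorm w"
proof (cases "enorm w = 0")
  case True
  then have "w \<bullet> w = 0" using enorm_sq[of w] by simp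
  then show ?thesis using scalar_prod_self_eq_0[OF assms] True by simp
next
  case False
  then have w: "enorm w > 0" using enorm_nonneg[of w] by simp
  show ?thesis
  proof (cases "enorm v = 0")
    case True
    then have "v \<bullet> v = 0" using enorm_sq[of v] by simp
    then show ?thesis using scalar_prod_self_eq_0[OF assms(2,1)] comm[OF assms] True by simp
  next
    case False
    then have v: "enorm v > 0" using enorm_nonneg[of v] by simp
    \<comment> \<open>This choice of \<open>c\<close> makes the two squares in \<open>young\<close>
      equal.\<close>
    have "2 * (enorm v / enorm w) * (v \<bullet> w) \<le> 2 * (enorm v)\<^sup>2"
      using young[OF assms, of "enorm v / enorm w"] w
      by (simp add: enorm_sq[symmetric] power_divide)
    then have "enorm v * (v \<bullet> w) \<le> enorm v * (enorm v * enorm w)"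
      using w by (simp add: field_simps power2_eq_square)
    then show ?thesis using v by simp
  qed
qed

lemma abs_cauchy_schwarz:
  fixes v w :: "real vec"
  assumes "v \<in> carrier_vec d" "w \<in> carrier_vec d"
  shows "\<bar>v \<bullet> w\<bar> \<le> enorm v * enorm w"
proof -
  have "-1 * (v \<bullet> w) = (-1 \<cdot>\<^sub>v v) \<bullet> w" using assms by (simp add: bilinear)
  also have "\<dots> \<le> enorm (-1 \<cdot>\<^sub>v v) * enorm w" using assms by (intro cauchy_schwarz) auto
  also have "\<dots> = enorm v * enorm w" by (simp add: enorm_smult)
  finally show ?thesis using cauchy_schwarz[OF assms] by simp
qed

section \<open>Gradients\<close>

lemma has_gradient_along:
  assumes "has_gradient d F u g" "u \<in> carrier_vec d" "w \<in> carrier_vec d" "\<epsilon> > 0"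
  shows "\<exists>\<eta>>0. \<forall>t. \<bar>t\<bar> < \<eta> \<longrightarrow> \<bar>F (u + t \<cdot>\<^sub>v w) - F u - t * (g \<bullet> w)\<bar> \<le> \<epsilon> * \<bar>t\<bar>"
proof -
  \<comment> \<open>The added 1 keeps the divisor positive when \<open>w\<close> is zero.\<close>
  let ?n = "enorm w + 1"
  have n: "?n > 0" using enorm_nonneg[of w] by simp
  have g: "g \<in> carrier_vec d" using assms by (simp add: has_gradient_def)
  have "\<epsilon> / ?n > 0" using assms(4) n by simp
  with assms(1) obtain \<delta> where \<delta>: "\<delta> > 0"
    "\<forall>v\<in>carrier_vec d. enorm (v - u) < \<delta> \<longrightarrow>
      \<bar>F v - F u - g \<bullet> (v - u)\<bar> \<le> \<epsilon> / ?n * enorm (v - u)"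
    unfolding has_gradient_def by blast
  have "\<bar>F (u + t \<cdot>\<^sub>v w) - F u - t * (g \<bullet> w)\<bar> \<le> \<epsilon> * \<bar>t\<bar>" if t: "\<bar>t\<bar> < \<delta> / ?n" for t
  proof -
    have eq: "u + t \<cdot>\<^sub>v w - u = t \<cdot>\<^sub>v w" using assms by (intro eq_vecI) auto
    have le: "\<bar>t\<bar> * enorm w \<le> \<bar>t\<bar> * ?n" by (simp add: mult_left_mono)
    also have "\<dots> < \<delta>" using t n by (simp add: field_simps)
    finally have "enorm (u + t \<cdot>\<^sub>v w - u) < \<delta>" by (simp add: eq enorm_smult)
    then have "\<bar>F (u + t \<cdot>\<^sub>v w) - F u - g \<bullet> (u + t \<cdot>\<^sub>v w - u)\<bar>
        \<le> \<epsilon> / ?n * enorm (u + t \<cdot>\<^sub>v w - u)"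
      using \<delta>(2) assms by simp
    also have "\<dots> = \<epsilon> / ?n * (\<bar>t\<bar> * enorm w)" by (simp add: eq enorm_smult)
    also have "\<dots> \<le> \<epsilon> / ?n * (\<bar>t\<bar> * ?n)"
      using le n assms(4) by (intro mult_left_mono) auto
    also have "\<dots> = \<epsilon> * \<bar>t\<bar>" using n by simp
    finally show ?thesis using assms g by (simp add: eq bilinear)
  qed
  then show ?thesis using \<delta>(1) n by (intro exI[of _ "\<delta> / ?n"]) auto
qed

text \<open>Restricting to a line turns the gradient into an ordinary derivative, so that
  one-variable calculus applies.\<close>

lemma has_gradient_DERIV:
  assumes "has_gradient d F (u + t \<cdot>\<^sub>v w) g" "u \<in> carrier_vec d" "w \<in> carrier_vec d"
  shows "((\<lambda>s. F (u + s \<cdot>\<^sub>v w)) has_real_derivative g \<bullet> w) (at t)"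
  unfolding DERIV_def LIM_def
proof (intro allI impI)
  fix r :: real assume r: "r > 0"
  have c: "u + t \<cdot>\<^sub>v w \<in> carrier_vec d" using assms by simp
  from has_gradient_along[OF assms(1) c assms(3), of "r / 2"] r
  obtain \<eta> where \<eta>: "\<eta> > 0" "\<And>h. \<bar>h\<bar> < \<eta> \<Longrightarrow>
      \<bar>F (u + t \<cdot>\<^sub>v w + h \<cdot>\<^sub>v w) - F (u + t \<cdot>\<^sub>v w) - h * (g \<bullet> w)\<bar> \<le> r / 2 * \<bar>h\<bar>"
    by auto
  show "\<exists>s>0. \<forall>h. h \<noteq> 0 \<and> dist h 0 < s \<longrightarrow>
      dist ((F (u + (t + h) \<cdot>\<^sub>v w) - F (u + t \<cdot>\<^sub>v w)) / h) (g \<bullet> w) < r"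
  proof (intro exI[of _ \<eta>] conjI allI impI)
    fix h :: real assume h: "h \<noteq> 0 \<and> dist h 0 < \<eta>"
    have eq: "u + (t + h) \<cdot>\<^sub>v w = u + t \<cdot>\<^sub>v w + h \<cdot>\<^sub>v w"
      using assms by (intro eq_vecI) (auto simp: algebra_simps)
    let ?q = "F (u + (t + h) \<cdot>\<^sub>v w) - F (u + t \<cdot>\<^sub>v w)"
    have "(?q / h - g \<bullet> w) * h = ?q - h * (g \<bullet> w)"
      using h by (simp add: left_diff_distrib diff_divide_distrib)
    then have "\<bar>?q / h - g \<bullet> w\<bar> * \<bar>h\<bar> = \<bar>?q - h * (g \<bullet> w)\<bar>"
      by (simp only: abs_mult[symmetric])
    also have "\<dots> \<le> r / 2 * \<bar>h\<bar>" using \<eta>(2)[of h] h by (simp add: eq)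
    finally have "\<bar>?q / h - g \<bullet> w\<bar> \<le> r / 2" using h by simp
    then show "dist (?q / h) (g \<bullet> w) < r" using r by (simp add: dist_real_def)
  qed (rule \<eta>(1))
qed

text \<open>Directional derivatives are unique, and the directions \<open>unit_vec d i\<close> read
  off every coordinate. The \<open>THE\<close> in \<open>gradient\<close> is thereby well
  defined.\<close>

lemma has_gradient_unique:
  assumes "has_gradient d F u g" "has_gradient d F u g'" "u \<in> carrier_vec d"
  shows "g = g'"
proof -
  have c: "g \<in> carrier_vec d" "g' \<in> carrier_vec d" using assms by (auto simp: has_gradient_def)
  have u: "u + 0 \<cdot>\<^sub>v w = u" if "w \<in> carrier_vec d" for w
    using that assms(3) by (intro eq_vecI) auto
  have eq: "g \<bullet> w = g' \<bullet> w" if "w \<in> carrier_vec d" for w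
    using has_gradient_DERIV[of F u 0 w g] has_gradient_DERIV[of F u 0 w g'] assms that
    by (auto simp: u intro: DERIV_unique)
  show ?thesis
  proof (intro eq_vecI)
    fix i assume "i < dim_vec g'"
    then show "g $ i = g' $ i" using eq[of "unit_vec d i"] c by simp
  qed (use c in auto)
qed

end

section \<open>Convex functions with Lipschitz gradient\<close>

locale smooth_convex = vec_dim +
  fixes L :: real and f :: "real vec \<Rightarrow> ereal"
  assumes L_pos: "0 < L"
    and convex: "convex_fun d f"
    and smooth: "lipschitz_smooth d L f"
begin

definition F :: "real vec \<Rightarrow> real" where "F v = real_of_ereal (f v)"

abbreviation G :: "real vec \<Rightarrow> real vec" where "G \<equiv> gradient d f"

lemma f_eq_F: "u \<in> carrier_vec d \<Longrightarrow> f u = ereal (F u)"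
  using smooth unfolding lipschitz_smooth_def F_def by (auto simp: ereal_real)

lemma has_gradient_G:
  assumes "u \<in> carrier_vec d"
  shows "has_gradient d F u (G u)"
proof -
  from smooth assms obtain g where g: "has_gradient d F u g"
    unfolding lipschitz_smooth_def F_def by blast
  then have "(THE g. has_gradient d F u g) = g"
    using has_gradient_unique[OF _ _ assms] by blast
  then show ?thesis using g by (simp add: gradient_def F_def[abs_def])
qed

lemma G_carrier [simp]: "u \<in> carrier_vec d \<Longrightarrow> G u \<in> carrier_vec d"
  using has_gradient_G[of u] by (simp add: has_gradient_def)

lemma G_lipschitz:
  "u \<in> carrier_vec d \<Longrightarrow> v \<in> carrier_vec d \<Longrightarrow> enorm (G u - G v) \<le> L * enorm (u - v)"
  using smooth by (simp add: lipschitz_smooth_def)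

text \<open>Convexity bounds \<open>F\<close> from above at a point near \<open>u\<close> on the
  segment to \<open>v\<close>, and differentiability bounds it from below up to
  \<open>\<epsilon> * t\<close>. Dividing by \<open>t\<close> leaves the error
  \<open>\<epsilon>\<close>.\<close>

lemma gradient_inequality:
  assumes u: "u \<in> carrier_vec d" and v: "v \<in> carrier_vec d"
  shows "F u + G u \<bullet> (v - u) \<le> F v"
proof -
  let ?w = "v - u"
  have w: "?w \<in> carrier_vec d" using assms by simp
  have "F u + G u \<bullet> ?w \<le> F v + \<epsilon>" if \<epsilon>: "\<epsilon> > 0" for \<epsilon>
  proof -
    from has_gradient_along[OF has_gradient_G[OF u] u w \<epsilon>]
    obtain \<eta> where \<eta>: "\<eta> > 0" "\<And>t. \<bar>t\<bar> < \<eta> \<Longrightarrow>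
      \<bar>F (u + t \<cdot>\<^sub>v ?w) - F u - t * (G u \<bullet> ?w)\<bar> \<le> \<epsilon> * \<bar>t\<bar>" by blast
    define t where "t = min (1/2) (\<eta> / 2)"
    have t: "0 < t" "t < 1" "\<bar>t\<bar> < \<eta>" using \<eta>(1) by (auto simp: t_def min_def)
    have eq: "(1 - t) \<cdot>\<^sub>v u + t \<cdot>\<^sub>v v = u + t \<cdot>\<^sub>v ?w"
      using assms by (intro eq_vecI) (auto simp: algebra_simps)
    have "f ((1 - t) \<cdot>\<^sub>v u + t \<cdot>\<^sub>v v) \<le> ereal (1 - t) * f u + ereal t * f v"
      using convex assms t unfolding convex_fun_def by blast
    then have "F (u + t \<cdot>\<^sub>v ?w) \<le> (1 - t) * F u + t * F v"
      using assms by (simp add: eq f_eq_F)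
    with \<eta>(2)[OF t(3)] t have "t * (G u \<bullet> ?w) - \<epsilon> * t \<le> t * (F v - F u)"
      by (simp add: algebra_simps abs_le_iff)
    then have "t * (F u + G u \<bullet> ?w) \<le> t * (F v + \<epsilon>)" by (simp add: algebra_simps)
    then show ?thesis using t by simp
  qed
  then show ?thesis by (rule field_le_epsilon)
qed

text \<open>Along the segment, \<open>\<psi>\<close> is \<open>F\<close> minus the linear and
  quadratic terms of the bound, up to the constant \<open>F u\<close>. The Lipschitz condition and
  Cauchy-Schwarz make its derivative nonpositive.\<close>

lemma descent:
  assumes u: "u \<in> carrier_vec d" and w: "w \<in> carrier_vec d"
  shows "F (u + w) \<le> F u + G u \<bullet> w + L / 2 * (w \<bullet> w)"
proof -
  define \<psi> where "\<psi> t = F (u + t \<cdot>\<^sub>v w) - t * (G u \<bullet> w) - L / 2 * t\<^sup>2 * (w \<bullet> w)" for t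
  have "\<psi> 0 \<ge> \<psi> 1"
  proof (rule DERIV_nonpos_imp_nonincreasing[where f = \<psi>])
    fix t :: real assume t: "0 \<le> t" "t \<le> 1"
    let ?u = "u + t \<cdot>\<^sub>v w"
    have c: "?u \<in> carrier_vec d" using assms by simp
    have "(\<psi> has_real_derivative G ?u \<bullet> w - G u \<bullet> w - L * t * (w \<bullet> w)) (at t)"
      unfolding \<psi>_def
      by (rule derivative_eq_intros has_gradient_DERIV[OF has_gradient_G[OF c] u w] refl | simp)+
    moreover have "G ?u \<bullet> w - G u \<bullet> w \<le> L * t * (w \<bullet> w)"
    proof -
      have eq: "?u - u = t \<cdot>\<^sub>v w" using assms by (intro eq_vecI) auto
      have "G ?u \<bullet> w - G u \<bullet> w = (G ?u - G u) \<bullet> w" using assms c by (simp add: bilinear)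
      also have "\<dots> \<le> enorm (G ?u - G u) * enorm w" using assms c by (intro cauchy_schwarz) auto
      also have "\<dots> \<le> (L * enorm (?u - u)) * enorm w"
        using G_lipschitz[OF c u] by (intro mult_right_mono enorm_nonneg)
      also have "\<dots> = L * t * (w \<bullet> w)"
        using t by (simp add: eq enorm_smult enorm_sq[symmetric] power2_eq_square)
      finally show ?thesis .
    qed
    ultimately show "\<exists>y. (\<psi> has_real_derivative y) (at t) \<and> y \<le> 0"
      by (intro exI conjI) auto
  qed simp
  moreover have "u + 1 \<cdot>\<^sub>v w = u + w" using assms by (intro eq_vecI) auto
  moreover have "u + 0 \<cdot>\<^sub>v w = u" using assms by (intro eq_vecI) auto
  ultimately show ?thesis by (simp add: \<psi>_def)
qed

lemma cocoercive:
  assumes u: "u \<in> carrier_vec d" and v: "v \<in> carrier_vec d"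
  shows "F u + G u \<bullet> (v - u) + 1 / (2 * L) * ((G u - G v) \<bullet> (G u - G v)) \<le> F v"
proof -
  let ?p = "G u - G v"
  \<comment> \<open>Subtract from \<open>F\<close> the linear function with slope
    \<open>G u\<close>; \<open>?w\<close> minimizes the upper bound that \<open>descent\<close> at
    \<open>v\<close> gives for the difference. The gradient inequality at \<open>u\<close> bounds
    the same value from below.\<close>
  let ?w = "v + (1 / L) \<cdot>\<^sub>v ?p"
  have p: "?p \<in> carrier_vec d" using assms by simp
  have c: "?w \<in> carrier_vec d" using assms by simp
  have w: "?w - u = (v - u) + (1 / L) \<cdot>\<^sub>v ?p"
    using minus_smult_shift(1)[OF v p u, of "1 / L"] .
  have sq: "L / 2 * (((1 / L) \<cdot>\<^sub>v ?p) \<bullet> ((1 / L) \<cdot>\<^sub>v ?p)) = 1 / (2 * L) * (?p \<bullet> ?p)"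
    using L_pos by simp
  have pp: "1 / L * (G u \<bullet> ?p) - 1 / L * (G v \<bullet> ?p) = 1 / L * (?p \<bullet> ?p)"
    using minus_scalar_prod_distrib[of "G u" d "G v" ?p] assms p
    by (simp add: diff_divide_distrib)
  have "F u + (G u \<bullet> (v - u) + 1 / L * (G u \<bullet> ?p)) \<le> F ?w"
    using gradient_inequality[OF u c] assms p unfolding w by (simp add: bilinear(2,6))
  also have "\<dots> \<le> F v + 1 / L * (G v \<bullet> ?p) + 1 / (2 * L) * (?p \<bullet> ?p)"
    using descent[OF v, of "(1 / L) \<cdot>\<^sub>v ?p"] sq assms p by (simp add: bilinear(6))
  finally have "F u + G u \<bullet> (v - u) + 1 / L * (?p \<bullet> ?p) \<le> F v + 1 / (2 * L) * (?p \<bullet> ?p)"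
    using pp by linarith
  moreover have "1 / L * (?p \<bullet> ?p) = 1 / (2 * L) * (?p \<bullet> ?p) + 1 / (2 * L) * (?p \<bullet> ?p)"
    using L_pos by (simp add: field_simps)
  ultimately show ?thesis by linarith
qed

text \<open>By \<open>descent\<close>, a gradient step of length \<open>1 / L\<close> lowers
  \<open>F\<close> by at least the squared gradient norm over \<open>2 * L\<close>.\<close>

lemma gradient_at_minimizer:
  assumes "minimizer d f xs"
  shows "G xs \<bullet> G xs = 0"
proof -
  have c: "xs \<in> carrier_vec d" using assms by (simp add: minimizer_def)
  let ?w = "(- 1 / L) \<cdot>\<^sub>v G xs"
  have "F xs \<le> F (xs + ?w)"
    using assms c f_eq_F by (auto simp: minimizer_def dest!: bspec[of _ _ "xs + ?w"])
  also have "\<dots> \<le> F xs - 1 / L * (G xs \<bullet> G xs) + 1 / (2 * L) * (G xs \<bullet> G xs)"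
    using descent[OF c, of ?w] c L_pos by (simp add: bilinear field_simps)
  finally have "1 / (2 * L) * (G xs \<bullet> G xs) \<le> 0" using L_pos by (simp add: field_simps)
  then show ?thesis
    using L_pos scalar_prod_self_nonneg[of "G xs"] by (auto simp: divide_le_0_iff mult_le_0_iff)
qed

lemma cocoercive_minimizer:
  assumes "minimizer d f xs" and u: "u \<in> carrier_vec d"
  shows "F u + G u \<bullet> (xs - u) + 1 / (2 * L) * (G u \<bullet> G u) \<le> F xs"
    and "F xs + 1 / (2 * L) * (G u \<bullet> G u) \<le> F u"
proof -
  have c: "xs \<in> carrier_vec d" using assms by (simp add: minimizer_def)
  note z = gradient_at_minimizer[OF assms(1)]
  have zero: "v \<bullet> G xs = 0" "G xs \<bullet> v = 0" if "v \<in> carrier_vec d" for v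
    using that c z comm[of "G xs" v] scalar_prod_self_eq_0[of v d "G xs"] by simp_all
  show "F u + G u \<bullet> (xs - u) + 1 / (2 * L) * (G u \<bullet> G u) \<le> F xs"
    using cocoercive[OF u c] u c zero by (simp add: bilinear)
  show "F xs + 1 / (2 * L) * (G u \<bullet> G u) \<le> F u"
    using cocoercive[OF c u] u c zero by (simp add: bilinear)
qed

text \<open>Cocoercivity for the pair \<open>X\<close>, \<open>X'\<close> with weight
  \<open>A'\<close> is added to cocoercivity for \<open>X\<close>, \<open>xs\<close> with weight
  \<open>a\<close>. The convex combination defining \<open>X\<close> eliminates
  \<open>G X \<bullet> X\<close>, and the step length \<open>1 / L\<close> makes the terms in
  \<open>G X \<bullet> G X'\<close> cancel.\<close>

lemma gap_step:
  assumes min: "minimizer d f xs"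
    and c: "X \<in> carrier_vec d" "X' \<in> carrier_vec d" "Z \<in> carrier_vec d" "E \<in> carrier_vec d"
    and A: "0 \<le> A'" "0 \<le> a" "A = A' + a" "0 < A"
    and X: "X = (1 - a / A) \<cdot>\<^sub>v (X' - (1 / L) \<cdot>\<^sub>v (G X' + E)) + (a / A) \<cdot>\<^sub>v Z"
  shows "A * (F X - F xs - 1 / (2 * L) * (G X \<bullet> G X))
    \<le> A' * (F X' - F xs - 1 / (2 * L) * (G X' \<bullet> G X'))
      - A / L * (G X \<bullet> G X) + a * (G X \<bullet> (Z - xs)) - A' / L * (G X \<bullet> E)"
proof -
  have xs: "xs \<in> carrier_vec d" using min by (simp add: minimizer_def)
  \<comment> \<open>With the inner products named, the rest is arithmetic in real numbers.\<close>
  define gg where "gg = G X \<bullet> G X"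
  define gg' where "gg' = G X' \<bullet> G X'"
  define g1 where "g1 = G X \<bullet> G X'"
  define gx where "gx = G X \<bullet> X"
  define gx' where "gx' = G X \<bullet> X'"
  define gz where "gz = G X \<bullet> Z"
  define gs where "gs = G X \<bullet> xs"
  define ge where "ge = G X \<bullet> E"
  note defs = gg_def gg'_def g1_def gx_def gx'_def gz_def gs_def ge_def
  have "gx = G X \<bullet> ((1 - a / A) \<cdot>\<^sub>v (X' - (1 / L) \<cdot>\<^sub>v (G X' + E)) + (a / A) \<cdot>\<^sub>v Z)"
    unfolding gx_def by (subst X[symmetric]) (rule refl)
  also have "\<dots> = (1 - a / A) * (gx' - 1 / L * (g1 + ge)) + a / A * gz"
    using c by (simp add: defs bilinear)
  finally have "A * gx = A * (1 - a / A) * (gx' - 1 / L * (g1 + ge)) + A * (a / A) * gz"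
    by (simp only: distrib_left mult.assoc)
  moreover have "A * (1 - a / A) = A'" "A * (a / A) = a"
    using A(3,4) by (simp_all add: right_diff_distrib)
  ultimately have gx: "A * gx = A' * (gx' - 1 / L * (g1 + ge)) + a * gz" by (simp only:)
  have sq: "(G X - G X') \<bullet> (G X - G X') = gg - 2 * g1 + gg'"
    using c comm[of "G X'" "G X"] by (simp add: defs bilinear)
  have 1: "F X + (gx' - gx) + 1 / (2 * L) * (gg - 2 * g1 + gg') \<le> F X'"
    using cocoercive[OF c(1,2)] c unfolding sq by (simp add: defs bilinear)
  have 2: "F X + (gs - gx) + 1 / (2 * L) * gg \<le> F xs"
    using cocoercive_minimizer(1)[OF min c(1)] c xs by (simp add: defs bilinear)
  have "A' * (F X + (gx' - gx) + 1 / (2 * L) * (gg - 2 * g1 + gg'))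
      + a * (F X + (gs - gx) + 1 / (2 * L) * gg) \<le> A' * F X' + a * F xs"
    using 1 2 A by (intro add_mono mult_left_mono) auto
  note ineq = this
  define h where "h = 1 / (2 * L)"
  have h: "1 / (2 * L) = h" "A / L = A * (2 * h)" "A' / L = A' * (2 * h)" "1 / L = 2 * h"
    by (simp_all add: h_def)
  have "A * (F X - F xs - 1 / (2 * L) * gg)
    \<le> A' * (F X' - F xs - 1 / (2 * L) * gg') - A / L * gg + a * (gz - gs) - A' / L * ge"
    using ineq gx unfolding h unfolding A(3) by (simp add: algebra_simps)
  then show ?thesis using c xs by (simp add: defs bilinear)
qed

end

section \<open>The inexact accelerated method\<close>

declare ifgm_A.simps(2) [simp del] ifgm_alpha.simps(2) [simp del]

lemma ifgm_alpha_pos: "0 < ifgm_alpha k"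
  by (cases k) (simp_all add: ifgm_alpha.simps(2) next_alpha_def add_pos_nonneg ifgm_A_pos less_imp_le)

lemma ifgm_A_mono: "i \<le> j \<Longrightarrow> ifgm_A i \<le> ifgm_A j"
  by (erule lift_Suc_mono_le[rotated]) (simp add: ifgm_A_Suc ifgm_alpha_pos less_imp_le)

text \<open>Since \<open>A\<^sub>k\<close> is the square of \<open>\<alpha>\<^sub>k\<close>, the
  root in the recursion lies between \<open>2 * \<alpha>\<^sub>k\<close> and
  \<open>2 * \<alpha>\<^sub>k + 1\<close>. Hence \<open>\<alpha>\<^sub>k\<close> grows linearly and
  \<open>A\<^sub>k\<close> quadratically.\<close>

lemma ifgm_alpha_Suc_bounds:
  "ifgm_alpha k + 1 / 2 \<le> ifgm_alpha (Suc k)" "ifgm_alpha (Suc k) \<le> ifgm_alpha k + 1"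
proof -
  let ?a = "ifgm_alpha k"
  define s where "s = sqrt (4 * ?a\<^sup>2 + 1)"
  have eq: "ifgm_alpha (Suc k) = (1 + s) / 2"
    by (simp add: s_def ifgm_alpha.simps(2) next_alpha_def ifgm_A_eq_alpha_squared)
  have 1: "2 * ?a \<le> s"
    unfolding s_def by (rule real_le_rsqrt) (simp add: power_mult_distrib)
  have 2: "s \<le> 2 * ?a + 1"
    unfolding s_def using ifgm_alpha_pos[of k]
    by (intro real_le_lsqrt) (auto simp: power2_eq_square algebra_simps)
  show "?a + 1 / 2 \<le> ifgm_alpha (Suc k)" unfolding eq using 1 by (simp add: field_simps)
  show "ifgm_alpha (Suc k) \<le> ?a + 1" unfolding eq using 2 by (simp add: field_simps)
qed

lemma ifgm_alpha_bounds: "real k / 2 + 1 \<le> ifgm_alpha k" "ifgm_alpha k \<le> real k + 1"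
proof (induction k)
  case (Suc k)
  case 1 show ?case using ifgm_alpha_Suc_bounds(1)[of k] Suc(1) by (simp add: field_simps)
  case 2 show ?case using ifgm_alpha_Suc_bounds(2)[of k] Suc(2) by simp
qed auto

lemma ifgm_alpha_mono: "ifgm_alpha k \<le> ifgm_alpha (Suc k)"
  using ifgm_alpha_Suc_bounds(1)[of k] by linarith

text \<open>Each increment of \<open>A\<close> is the next weight, which is at least the current
  one.\<close>

lemma sum_ifgm_alpha_le: "(\<Sum>i<k. ifgm_alpha i) \<le> ifgm_A k"
proof (induction k)
  case (Suc k)
  then show ?case using ifgm_alpha_mono[of k] by (simp add: ifgm_A_Suc)
qed simp

section \<open>The energy argument along one run\<close>

locale ifgm_run = smooth_convex +
  fixes K :: nat and R :: real and xs :: "real vec" and b :: "nat \<Rightarrow> real"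
    and e x y z :: "nat \<Rightarrow> real vec"
  assumes min: "minimizer d f xs"
    and x0: "x 0 \<in> carrier_vec d"
    and R: "enorm (x 0 - xs) \<le> R"
    and err: "\<And>k. k < K \<Longrightarrow> e k \<in> carrier_vec d \<and> 0 \<le> b k \<and> (enorm (e k))\<^sup>2 \<le> (b k)\<^sup>2"
    and run: "iFGM L K (\<lambda>k. G (x k) + e k) x y z"
begin

abbreviation "A \<equiv> ifgm_A"
abbreviation "\<alpha> \<equiv> ifgm_alpha"

definition gap :: "nat \<Rightarrow> real" where
  "gap k = A k * (F (x k) - F xs - 1 / (2 * L) * (G (x k) \<bullet> G (x k)))"

text \<open>
  Besides the previous gap, \<open>prev_gap\<close> carries the cost of absorbing \<open>\<langle>\<nabla>f(x\<^bsub>j+1\<^esub>), e\<^sub>j\<rangle>\<close>, which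
  arises only in the next step.
\<close>

definition prev_gap :: "nat \<Rightarrow> real" where
  "prev_gap k = (case k of 0 \<Rightarrow> 0 | Suc j \<Rightarrow> gap j + A j * (b j)\<^sup>2 / L)"

definition dist_z :: "nat \<Rightarrow> real" where "dist_z k = enorm (z k - xs)"

lemma xs_carrier [simp]: "xs \<in> carrier_vec d"
  using min by (simp add: minimizer_def)

lemma iterates_carrier: "k \<le> K \<Longrightarrow> x k \<in> carrier_vec d \<and> z k \<in> carrier_vec d"
proof (induction k)
  case 0
  then show ?case using x0 run by (simp add: iFGM_def)
next
  case (Suc k)
  then have "x k \<in> carrier_vec d" "z k \<in> carrier_vec d" "e k \<in> carrier_vec d" using err by auto
  then show ?case using run Suc.prems unfolding iFGM_def by simp
qed

lemma err_sq: "k < K \<Longrightarrow> e k \<bullet> e k \<le> (b k)\<^sup>2"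
  using err enorm_sq by metis

lemma gap_nonneg: "k \<le> K \<Longrightarrow> 0 \<le> gap k"
  using cocoercive_minimizer(2)[OF min, of "x k"] iterates_carrier[of k] ifgm_A_pos[of k]
  by (simp add: gap_def)

lemma prev_gap_nonneg: "k \<le> K \<Longrightarrow> 0 \<le> prev_gap k"
  using L_pos by (auto simp: prev_gap_def ifgm_A_pos less_imp_le split: nat.split
      intro!: add_nonneg_nonneg gap_nonneg)

text \<open>Of the negative gradient term in \<open>gap_step\<close>, a quarter absorbs the product
  with the previous error and three quarters remain. At index 0 there is no previous iterate, and
  cocoercivity with the minimizer alone suffices because both initial weights are 1.\<close>

lemma gap_le_prev_gap:
  assumes k: "k \<le> K"
  shows "gap k \<le> prev_gap k - 3 / 4 * (A k / L) * (G (x k) \<bullet> G (x k))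
    + \<alpha> k * (G (x k) \<bullet> (z k - xs))"
proof (cases k)
  case 0
  have z0: "z 0 = x 0" using run by (simp add: iFGM_def)
  have "F (x 0) + G (x 0) \<bullet> (xs - x 0) + 1 / (2 * L) * (G (x 0) \<bullet> G (x 0)) \<le> F xs"
    by (rule cocoercive_minimizer(1)[OF min x0])
  moreover have "0 \<le> G (x 0) \<bullet> G (x 0) / L"
    using L_pos scalar_prod_self_nonneg by simp
  moreover have "1 / (2 * L) * (G (x 0) \<bullet> G (x 0)) = G (x 0) \<bullet> G (x 0) / L / 2" by simp
  ultimately have "F (x 0) - F xs - 1 / (2 * L) * (G (x 0) \<bullet> G (x 0))
      \<le> - 3 / 4 * (G (x 0) \<bullet> G (x 0) / L) - G (x 0) \<bullet> (xs - x 0)"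
    by linarith
  then show ?thesis using 0 x0 by (simp add: gap_def prev_gap_def z0 bilinear)
next
  case (Suc j)
  then have j: "j < K" using k by simp
  note c = iterates_carrier[OF k] iterates_carrier[of j] err[OF j]
  let ?g = "G (x k)"
  have "gap k \<le> gap j - A k / L * (?g \<bullet> ?g) + \<alpha> k * (?g \<bullet> (z k - xs)) - A j / L * (?g \<bullet> e j)"
    unfolding gap_def
  proof (rule gap_step[OF min])
    show "A k = A j + \<alpha> k" using Suc by (simp add: ifgm_A_Suc)
    show "x k = (1 - \<alpha> k / A k) \<cdot>\<^sub>v (x j - (1 / L) \<cdot>\<^sub>v (G (x j) + e j)) + (\<alpha> k / A k) \<cdot>\<^sub>v z k"
      using run j Suc unfolding iFGM_def by metis
  qed (use c j ifgm_A_pos ifgm_alpha_pos in \<open>auto simp: less_imp_le\<close>)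
  moreover have "- (A j / L * (?g \<bullet> e j)) \<le> 1 / 4 * (A k / L) * (?g \<bullet> ?g) + A j * (b j)\<^sup>2 / L"
  proof -
    \<comment> \<open>Weight -2 in \<open>young\<close> leaves the factor 1/4 on the
      gradient.\<close>
    have "- (?g \<bullet> e j) \<le> 1 / 4 * (?g \<bullet> ?g) + (e j \<bullet> e j)"
      using young[of ?g "e j" "-2"] c j by simp
    also have "\<dots> \<le> 1 / 4 * (?g \<bullet> ?g) + (b j)\<^sup>2" using err_sq[OF j] by simp
    finally have "A j / L * (- (?g \<bullet> e j)) \<le> A j / L * (1 / 4 * (?g \<bullet> ?g) + (b j)\<^sup>2)"
      using ifgm_A_pos[of j] L_pos by (intro mult_left_mono) auto
    moreover have "A j / L * (1 / 4 * (?g \<bullet> ?g)) \<le> A k / L * (1 / 4 * (?g \<bullet> ?g))"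
      using ifgm_A_mono[of j k] Suc L_pos scalar_prod_self_nonneg
      by (intro mult_right_mono divide_right_mono) auto
    ultimately show ?thesis by (simp add: algebra_simps)
  qed
  moreover have "prev_gap k = gap j + A j * (b j)\<^sup>2 / L" using Suc by (simp add: prev_gap_def)
  ultimately show ?thesis by linarith
qed

text \<open>Expanding the squared distance after the \<open>z\<close> step yields
  \<open>- \<alpha> k * (?g \<bullet> ?w)\<close>, which cancels the same product in
  \<open>gap_le_prev_gap\<close>. The squared gradient terms cancel exactly. The factor 5/2 is 3/2
  from the expansion plus the 1 stored in \<open>prev_gap\<close>.\<close>

lemma energy_step:
  assumes k: "k < K" and U: "dist_z k \<le> U"
  shows "prev_gap (Suc k) + L / 2 * (dist_z (Suc k))\<^sup>2
    \<le> prev_gap k + L / 2 * (dist_z k)\<^sup>2 + \<alpha> k * b k * U + 5 / 2 * (A k * (b k)\<^sup>2 / L)"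
proof -
  note c = iterates_carrier[of k] err[OF k]
  let ?g = "G (x k)" and ?w = "z k - xs"
  have ca: "?g \<in> carrier_vec d" "e k \<in> carrier_vec d" "?w \<in> carrier_vec d" using c k by auto
  have z: "z (Suc k) - xs = ?w - (1 / L * \<alpha> k) \<cdot>\<^sub>v (?g + e k)"
  proof -
    have "z (Suc k) = z k - (1 / L * \<alpha> k) \<cdot>\<^sub>v (?g + e k)" using run k by (simp add: iFGM_def)
    then show ?thesis using minus_smult_shift(2)[of "z k" "?g + e k" xs] c ca k by simp
  qed
  have "(dist_z (Suc k))\<^sup>2 = (dist_z k)\<^sup>2 - 2 * (1 / L * \<alpha> k) * (?w \<bullet> (?g + e k))
      + (1 / L * \<alpha> k)\<^sup>2 * ((?g + e k) \<bullet> (?g + e k))"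
    unfolding dist_z_def enorm_sq z using ca by (intro minus_smult_sq) auto
  then have "L / 2 * (dist_z (Suc k))\<^sup>2 = L / 2 * (dist_z k)\<^sup>2 - \<alpha> k * (?w \<bullet> (?g + e k))
      + A k / (2 * L) * ((?g + e k) \<bullet> (?g + e k))"
    using L_pos by (simp add: ifgm_A_eq_alpha_squared right_diff_distrib distrib_left power2_eq_square)
  also have "(?g + e k) \<bullet> (?g + e k) = ?g \<bullet> ?g + 2 * (?g \<bullet> e k) + e k \<bullet> e k"
    using ca comm[of "e k" ?g] by (simp add: bilinear)
  also have "?w \<bullet> (?g + e k) = ?g \<bullet> ?w + e k \<bullet> ?w"
    using ca comm[of ?w ?g] comm[of ?w "e k"] by (simp only: bilinear add_carrier_vec)
  finally have 1: "L / 2 * (dist_z (Suc k))\<^sup>2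
    = L / 2 * (dist_z k)\<^sup>2 - \<alpha> k * (?g \<bullet> ?w + e k \<bullet> ?w)
      + A k / (2 * L) * (?g \<bullet> ?g + 2 * (?g \<bullet> e k) + e k \<bullet> e k)" .
  have "- (e k \<bullet> ?w) \<le> b k * U"
  proof -
    have "- (e k \<bullet> ?w) \<le> enorm (e k) * enorm ?w"
      using abs_cauchy_schwarz[OF ca(2,3)] by simp
    also have "\<dots> \<le> b k * U"
      using c U enorm_nonneg[of ?w] by (intro mult_mono) (auto simp: dist_z_def intro: power2_le_imp_le)
    finally show ?thesis .
  qed
  then have 2: "\<alpha> k * (- (e k \<bullet> ?w)) \<le> \<alpha> k * (b k * U)"
    using ifgm_alpha_pos[of k] by (intro mult_left_mono) auto
  \<comment> \<open>Weight 2 in \<open>young\<close> gives 3/2 here; half of it is the 3/4 left over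
    by \<open>gap_le_prev_gap\<close>.\<close>
  have "?g \<bullet> ?g + 2 * (?g \<bullet> e k) + e k \<bullet> e k \<le> 3 / 2 * (?g \<bullet> ?g) + 3 * (b k)\<^sup>2"
    using young[OF ca(1,2), of 2] err_sq[OF k] by simp
  then have 3: "A k / (2 * L) * (?g \<bullet> ?g + 2 * (?g \<bullet> e k) + e k \<bullet> e k)
      \<le> A k / (2 * L) * (3 / 2 * (?g \<bullet> ?g) + 3 * (b k)\<^sup>2)"
    using ifgm_A_pos[of k] L_pos by (intro mult_left_mono) auto
  have 4: "gap k \<le> prev_gap k - 3 / 4 * (A k / L) * (?g \<bullet> ?g) + \<alpha> k * (?g \<bullet> ?w)"
    using gap_le_prev_gap k by simp
  have 5: "prev_gap (Suc k) = gap k + A k * (b k)\<^sup>2 / L" by (simp add: prev_gap_def)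
  show ?thesis using 1 2 3 4 5 by (simp add: algebra_simps)
qed

lemma energy_bound:
  assumes "k \<le> K" and U: "\<And>i. i \<le> K \<Longrightarrow> dist_z i \<le> U"
  shows "prev_gap k + L / 2 * (dist_z k)\<^sup>2
    \<le> L / 2 * R\<^sup>2 + (\<Sum>i<k. \<alpha> i * b i * U + 5 / 2 * (A i * (b i)\<^sup>2 / L))"
  using assms(1)
proof (induction k)
  case 0
  have "z 0 = x 0" using run by (simp add: iFGM_def)
  then have "(dist_z 0)\<^sup>2 \<le> R\<^sup>2" using R enorm_nonneg by (simp add: dist_z_def power_mono)
  then show ?case using L_pos by (simp add: prev_gap_def)
next
  case (Suc k)
  then show ?case using energy_step[of k U] U[of k] by simp
qed

text \<open>The energy bound is used twice: at the index of the maximum it bounds \<open>U\<close>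
  by the data, and at \<open>K\<close> it then bounds the gap.\<close>

lemma gap_le:
  "gap K \<le> L * R\<^sup>2 + 7 * A K / L * (\<Sum>i<K. \<alpha> (Suc i) * (b i)\<^sup>2)"
proof -
  define U where "U = Max (dist_z ` {..K})"
  have U: "dist_z i \<le> U" if "i \<le> K" for i using that by (simp add: U_def)
  have "U \<in> dist_z ` {..K}" unfolding U_def by (intro Max_in) auto
  then obtain m where m: "m \<le> K" "dist_z m = U" by auto
  define S where "S = (\<Sum>i<K. \<alpha> (Suc i) * (b i)\<^sup>2)"
  have U0: "0 \<le> U" using m enorm_nonneg by (auto simp: dist_z_def)
  have AK: "A K > 0" by (rule ifgm_A_pos)
  have summand: "\<alpha> i * b i * U + 5 / 2 * (A i * (b i)\<^sup>2 / L)
      \<le> \<alpha> i * (L * U\<^sup>2 / (4 * A K)) + 7 / 2 * (A K / L * (\<alpha> (Suc i) * (b i)\<^sup>2))"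
    if i: "i < K" for i
  proof -
    \<comment> \<open>This balance puts \<open>4 * A K\<close> under the \<open>U\<close> term, so
      that summation against the weights costs at most \<open>L * U\<^sup>2 / 4\<close>.\<close>
    have "0 \<le> (L * U / (2 * A K) - b i)\<^sup>2" by simp
    then have "L * U / A K * b i \<le> (L * U / (2 * A K))\<^sup>2 + (b i)\<^sup>2"
      by (simp add: power2_diff)
    then have "A K / L * (L * U / A K * b i) \<le> A K / L * ((L * U / (2 * A K))\<^sup>2 + (b i)\<^sup>2)"
      using AK L_pos by (intro mult_left_mono) auto
    then have "b i * U \<le> L * U\<^sup>2 / (4 * A K) + A K / L * (b i)\<^sup>2"
      using AK L_pos by (simp add: distrib_left power2_eq_square mult.commute mult.left_commute)
    then have "\<alpha> i * (b i * U) \<le> \<alpha> i * (L * U\<^sup>2 / (4 * A K) + A K / L * (b i)\<^sup>2)"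
      using ifgm_alpha_pos[of i] by (intro mult_left_mono) auto
    then have 1: "\<alpha> i * b i * U \<le> \<alpha> i * (L * U\<^sup>2 / (4 * A K)) + A K / L * (\<alpha> i * (b i)\<^sup>2)"
      by (simp add: distrib_left mult.left_commute mult.assoc)
    have 2: "A K / L * (\<alpha> i * (b i)\<^sup>2) \<le> A K / L * (\<alpha> (Suc i) * (b i)\<^sup>2)"
      using ifgm_alpha_mono[of i] AK L_pos
      by (intro mult_left_mono mult_right_mono) auto
    have 3: "A i * (b i)\<^sup>2 / L \<le> A K / L * (\<alpha> (Suc i) * (b i)\<^sup>2)"
    proof -
      have "1 \<le> \<alpha> (Suc i)" using ifgm_alpha_bounds(1)[of "Suc i"] by linarith
      then have "A i * (b i)\<^sup>2 \<le> A K * (\<alpha> (Suc i) * (b i)\<^sup>2)"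
        using ifgm_A_mono[of i K] i AK
        by (intro mult_mono) (auto simp: mult_le_cancel_right1)
      then show ?thesis using L_pos by (simp add: divide_right_mono)
    qed
    \<comment> \<open>The factor 7/2 collects 1 from the inner product with the error and 5/2 from
      the squared errors.\<close>
    have "p + 5 / 2 * r \<le> q + 7 / 2 * t"
      if "p \<le> q + s" "s \<le> t" "r \<le> t" for p q r s t :: real
      using that by (simp add: field_simps)
    from this[OF 1 2 3] show ?thesis .
  qed
  \<comment> \<open>The maximum may occur at any index, so partial sums are needed; nonnegative
    summands let the full sum bound them.\<close>
  have sum: "(\<Sum>i<k. \<alpha> i * b i * U + 5 / 2 * (A i * (b i)\<^sup>2 / L))
      \<le> L * U\<^sup>2 / 4 + 7 / 2 * (A K / L * S)" if "k \<le> K" for k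
  proof -
    have "(\<Sum>i<k. \<alpha> i * b i * U + 5 / 2 * (A i * (b i)\<^sup>2 / L))
      \<le> (\<Sum>i<K. \<alpha> i * b i * U + 5 / 2 * (A i * (b i)\<^sup>2 / L))"
      using that err U0 L_pos ifgm_alpha_pos ifgm_A_pos
      by (intro sum_mono2) (auto intro!: add_nonneg_nonneg simp: less_imp_le)
    also have "\<dots> \<le> (\<Sum>i<K. \<alpha> i * (L * U\<^sup>2 / (4 * A K)) + 7 / 2 * (A K / L * (\<alpha> (Suc i) * (b i)\<^sup>2)))"
      using summand by (intro sum_mono) auto
    also have "\<dots> = (\<Sum>i<K. \<alpha> i) * (L * U\<^sup>2 / (4 * A K)) + 7 / 2 * (A K / L * S)"
      by (simp only: sum.distrib sum_distrib_left sum_distrib_right S_def)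
    also have "(\<Sum>i<K. \<alpha> i) * (L * U\<^sup>2 / (4 * A K)) \<le> A K * (L * U\<^sup>2 / (4 * A K))"
      using sum_ifgm_alpha_le L_pos AK by (intro mult_right_mono) auto
    finally show ?thesis using AK by simp
  qed
  have energy: "prev_gap k + L / 2 * (dist_z k)\<^sup>2
      \<le> L / 2 * R\<^sup>2 + (L * U\<^sup>2 / 4 + 7 / 2 * (A K / L * S))" if "k \<le> K" for k
    using energy_bound[OF that U] add_left_mono[OF sum[OF that]] by (rule order_trans)
  have "L / 2 * U\<^sup>2 \<le> prev_gap m + L / 2 * (dist_z m)\<^sup>2"
    using prev_gap_nonneg[OF m(1)] m(2) by simp
  also note energy[OF m(1)]
  finally have 1: "L / 2 * U\<^sup>2 \<le> L / 2 * R\<^sup>2 + (L * U\<^sup>2 / 4 + 7 / 2 * (A K / L * S))" .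
  note cK = iterates_carrier[of K]
  let ?g = "G (x K)" and ?w = "z K - xs"
  have "gap K \<le> prev_gap K + L / 2 * (dist_z K)\<^sup>2"
  proof -
    \<comment> \<open>No \<open>z\<close> step follows index \<open>K\<close>. The remaining product
      is therefore split by \<open>young\<close>, spending 1/2 of the available 3/4 of the gradient
      term.\<close>
    have "2 * (\<alpha> K / L) * (?w \<bullet> ?g) \<le> (dist_z K)\<^sup>2 + A K / L\<^sup>2 * (?g \<bullet> ?g)"
      using young[of ?w ?g "\<alpha> K / L"] cK
      by (simp add: dist_z_def enorm_sq ifgm_A_eq_alpha_squared power_divide)
    then have "L / 2 * (2 * (\<alpha> K / L) * (?w \<bullet> ?g))
        \<le> L / 2 * ((dist_z K)\<^sup>2 + A K / L\<^sup>2 * (?g \<bullet> ?g))"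
      using L_pos by (intro mult_left_mono) auto
    then have "\<alpha> K * (?g \<bullet> ?w) \<le> L / 2 * (dist_z K)\<^sup>2 + 1 / 2 * (A K / L) * (?g \<bullet> ?g)"
      using L_pos comm[of ?w ?g] cK by (simp add: distrib_left power2_eq_square)
    moreover have "0 \<le> 1 / 4 * (A K / L) * (?g \<bullet> ?g)"
      using L_pos AK scalar_prod_self_nonneg[of ?g] by simp
    ultimately show ?thesis using gap_le_prev_gap[of K] by (simp add: algebra_simps)
  qed
  also have "\<dots> \<le> L / 2 * R\<^sup>2 + (L * U\<^sup>2 / 4 + 7 / 2 * (A K / L * S))"
    by (rule energy) simp
  also have "\<dots> \<le> L * R\<^sup>2 + 7 * (A K / L * S)"
  proof -
    \<comment> \<open>The premise bounds \<open>u / 4\<close> by \<open>r / 2 + 7 / 2 * q\<close>;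
      substituting this doubles both terms.\<close>
    have "r / 2 + (u / 4 + 7 / 2 * q) \<le> r + 7 * q"
      if "u / 2 \<le> r / 2 + (u / 4 + 7 / 2 * q)" for r u q :: real
      using that by (simp add: field_simps)
    from this[of "L * U\<^sup>2" "L * R\<^sup>2" "A K / L * S"] 1 show ?thesis by simp
  qed
  finally show ?thesis by (simp add: S_def)
qed

lemma residual_le:
  "F (x K) - F xs - 1 / (2 * L) * (enorm (G (x K)))\<^sup>2
    \<le> L * R\<^sup>2 / A K + 7 / L * (\<Sum>i<K. \<alpha> (Suc i) * (b i)\<^sup>2)"
proof -
  let ?r = "L * R\<^sup>2 / A K + 7 / L * (\<Sum>i<K. \<alpha> (Suc i) * (b i)\<^sup>2)"
  have AK: "A K > 0" by (rule ifgm_A_pos)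
  have "A K * (F (x K) - F xs - 1 / (2 * L) * (enorm (G (x K)))\<^sup>2) = gap K"
    by (simp add: gap_def enorm_sq)
  also have "\<dots> \<le> A K * ?r" using gap_le AK by (simp add: distrib_left mult.assoc mult.left_commute[of 7])
  finally show ?thesis using AK by simp
qed

text \<open>The infimum is attained at \<open>xs\<close> and all values are finite, so the extended
  real expression is a real one.\<close>

lemma residual_eq:
  "f (x K) - min_value d f - ereal (1 / (2 * L) * (enorm (G (x K)))\<^sup>2)
    = ereal (F (x K) - F xs - 1 / (2 * L) * (enorm (G (x K)))\<^sup>2)"
proof -
  have "min_value d f = f xs"
    using min unfolding min_value_def minimizer_def by (intro antisym INF_lower INF_greatest) auto
  then show ?thesis using iterates_carrier[of K] by (simp add: f_eq_F)
qed

end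

theorem theorem4:
  shows "\<exists>cH>0. \<exists>C>0. \<forall>d f L R K xs b e x y z.
    0 < L \<and>
    proper_fun d f \<and> closed_fun d f \<and> convex_fun d f \<and> lipschitz_smooth d L f \<and>
    minimizer d f xs \<and>
    x 0 \<in> carrier_vec d \<and> enorm (x 0 - xs) \<le> R \<and>
    1 \<le> K \<and>
    (\<forall>k<K. e k \<in> carrier_vec d \<and> 0 \<le> b k \<and> (enorm (e k))\<^sup>2 \<le> (b k)\<^sup>2) \<and>
    iFGM L K (\<lambda>k. gradient d f (x k) + e k) x y z
    \<longrightarrow>
    f (x K) - min_value d f - ereal (1 / (2 * L) * (enorm (gradient d f (x K)))\<^sup>2)
      \<le> ereal (4 * L * R\<^sup>2 / ifgm_A K + 2 * cH / L * (\<Sum>i<K. ifgm_alpha (i + 1) * (b i)\<^sup>2))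
    \<and>
    (\<forall>\<beta>. (\<forall>k<K. b k = \<beta>) \<longrightarrow>
      f (x K) - min_value d f - ereal (1 / (2 * L) * (enorm (gradient d f (x K)))\<^sup>2)
        \<le> ereal (C * (L * R\<^sup>2 / (real K)\<^sup>2 + (real K)\<^sup>2 * \<beta>\<^sup>2 / L)))"
proof (rule exI[of _ "7 / 2"], rule conjI, simp, rule exI[of _ 14], rule conjI, simp,
    intro allI impI, elim conjE)
  fix d f L R K xs b e x y z
  assume L: "(0::real) < L" and "convex_fun d f" "lipschitz_smooth d L f" "minimizer d f xs"
    "x 0 \<in> carrier_vec d" "enorm (x 0 - xs) \<le> R"
    and K: "1 \<le> K"
    and "\<forall>k<K. e k \<in> carrier_vec d \<and> 0 \<le> b k \<and> (enorm (e k))\<^sup>2 \<le> (b k)\<^sup>2"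
    "iFGM L K (\<lambda>k. gradient d f (x k) + e k) x y z"
  then interpret ifgm_run d L f K R xs b e x y z by unfold_locales auto
  let ?r = "F (x K) - F xs - 1 / (2 * L) * (enorm (G (x K)))\<^sup>2"
  have LRA: "0 \<le> L * R\<^sup>2 / A K" using L ifgm_A_pos[of K] by simp
  \<comment> \<open>The value 7/2 of \<open>cH\<close> turns its factor 2 into the 7 of
    \<open>residual_le\<close>; the factor 4 on the distance term is slack.\<close>
  have "?r \<le> 4 * L * R\<^sup>2 / A K + 2 * (7 / 2) / L * (\<Sum>i<K. \<alpha> (i + 1) * (b i)\<^sup>2)"
    using residual_le LRA by simp
  moreover have "?r \<le> 14 * (L * R\<^sup>2 / (real K)\<^sup>2 + (real K)\<^sup>2 * \<beta>\<^sup>2 / L)"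
    if \<beta>: "\<forall>k<K. b k = \<beta>" for \<beta>
  proof -
    have "(real K / 2)\<^sup>2 \<le> A K"
      using ifgm_alpha_bounds(1)[of K] unfolding ifgm_A_eq_alpha_squared
      by (intro power_mono) auto
    then have "L * R\<^sup>2 / A K \<le> L * R\<^sup>2 / (real K / 2)\<^sup>2"
      using K L ifgm_A_pos[of K] by (intro divide_left_mono) auto
    also have "\<dots> = 4 * (L * R\<^sup>2 / (real K)\<^sup>2)" by (simp add: power_divide)
    also have "\<dots> \<le> 14 * (L * R\<^sup>2 / (real K)\<^sup>2)" using L by (intro mult_right_mono) auto
    finally have 1: "L * R\<^sup>2 / A K \<le> 14 * (L * R\<^sup>2 / (real K)\<^sup>2)" .
    \<comment> \<open>Each weight is at most \<open>K + 1\<close>, hence at most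
      \<open>2 * K\<close> as \<open>K\<close> is at least 1. The sum then contributes 7 times 2,
      which is the constant 14; the distance term alone would need 4.\<close>
    have "(\<Sum>i<K. \<alpha> (Suc i) * (b i)\<^sup>2) \<le> (\<Sum>i<K. (2 * real K) * \<beta>\<^sup>2)"
    proof (rule sum_mono)
      fix i assume i: "i \<in> {..<K}"
      then have "\<alpha> (Suc i) \<le> 2 * real K"
        using ifgm_alpha_bounds(2)[of "Suc i"] K by simp
      then show "\<alpha> (Suc i) * (b i)\<^sup>2 \<le> (2 * real K) * \<beta>\<^sup>2"
        using i \<beta> by (auto intro: mult_right_mono)
    qed
    also have "\<dots> = 2 * ((real K)\<^sup>2 * \<beta>\<^sup>2)" by (simp add: power2_eq_square)
    finally have "7 / L * (\<Sum>i<K. \<alpha> (Suc i) * (b i)\<^sup>2) \<le> 7 / L * (2 * ((real K)\<^sup>2 * \<beta>\<^sup>2))"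
      using L by (intro mult_left_mono) auto
    with residual_le 1 show ?thesis by (simp add: distrib_left)
  qed
  ultimately show "f (x K) - min_value d f - ereal (1 / (2 * L) * (enorm (gradient d f (x K)))\<^sup>2)
      \<le> ereal (4 * L * R\<^sup>2 / ifgm_A K + 2 * (7 / 2) / L * (\<Sum>i<K. ifgm_alpha (i + 1) * (b i)\<^sup>2))
    \<and>
    (\<forall>\<beta>. (\<forall>k<K. b k = \<beta>) \<longrightarrow>
      f (x K) - min_value d f - ereal (1 / (2 * L) * (enorm (gradient d f (x K)))\<^sup>2)
        \<le> ereal (14 * (L * R\<^sup>2 / (real K)\<^sup>2 + (real K)\<^sup>2 * \<beta>\<^sup>2 / L)))"
    unfolding residual_eq by simp
qed

end
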